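(* Let $q$ be a prime power, let $1\le r<k$, and let $C$ be a full-length $[n,k]_q$ code with associated projective multiset $\mathcal{M}_C$. Write $d_r=d_r(C)$ and $\delta_r=\delta_r(C)$. 1. Suppose that $C$ is an $r$-th generalized Griesmer code, and let $P$ be a point of maximum multiplicity in $\mathcal{M}_C$. Then $$\mathcal{M}_C(P)=\left\lceil\frac{d_r}{q^{k-r}{r\brack 1}_q}\right\rceil,\qquad n(C_P)=g_q^{(r)}(k-1,d_r),\qquad d_r(C_P)=d_r.$$ Consequently, $C_P$ has dimension $k-1$ and is an $r$-th generalized Griesmer code. 2. Suppose that $C$ is an $r$-th generalized antiGriesmer code, and let $P$ be a point of minimum multiplicity in $\mathcal{M}_C$. Then $$\mathcal{M}_C(P)=\left\lfloor\frac{\delta_r}{q^{k-r}{r\brack 1}_q}\right\rfloor,\qquad n(C_P)=a_q^{(r)}(k-1,\delta_r),\qquad \delta_r(C_P)=\delta_r.$$ Consequently, $C_P$ has dimension $k-1$ and is an $r$-th generalized antiGriesmer code.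
   Context: An $[n,k]_q$ code is a $k$-dimensional linear subspace $C\le\mathbb{F}_q^n$. For a subcode $A\le C$, $\mathrm{supp}(A)$ is the set of coordinates $j$ such that $a_j\neq 0$ for some $a\in A$, and $w(A)=|\mathrm{supp}(A)|$. The effective length of $C$ is $n(C)=w(C)$; $C$ has full length if $n(C)=n$. For $1\le r\le k$, $d_r(C)$ and $\delta_r(C)$ are respectively the minimum and the maximum of $w(A)$ over all $r$-dimensional subcodes $A\le C$. Put ${r\brack 1}_q=(q^r-1)/(q-1)$ and, for integers $x\ge 0$ and $1\le r\le k$, $$g_q^{(r)}(k,x)=x+\sum_{i=1}^{k-r}\left\lceil\frac{x}{q^i{r\brack 1}_q}\right\rceil,\qquad a_q^{(r)}(k,x)=x+\sum_{i=1}^{k-r}\left\lfloor\frac{x}{q^i{r\brack 1}_q}\right\rfloor$$ (empty sums are zero). A full-length $[n,k]_q$ code $C$ is an $r$-th generalized Griesmer code if $n=g_q^{(r)}(k,d_r(C))$, and an $r$-th generalized antiGriesmer code if $n=a_q^{(r)}(k,\delta_r(C))$. Let $G$ be a $k\times n$ generator matrix of the full-length code $C$, with (nonzero) columns $G_1,\dots,G_n$, and let $\mathcal{P}$ be the point set of $\mathrm{PG}(k-1,q)$, i.e. the set of one-dimensional subspaces of $\mathbb{F}_q^k$. The multiset $\mathcal{M}_C:\mathcal{P}\to\mathbb{Z}_{\ge0}$ is $\mathcal{M}_C(P)=\#\{j:\langle G_j\rangle=P\}$. A point of maximum (minimum) multiplicity is a point $P\in\mathcal{P}$ at which $\mathcal{M}_C$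 attains its maximum (minimum) over all of $\mathcal{P}$ (the minimum may be $0$). For $P=\langle p\rangle\in\mathcal{P}$, the shortened subcode associated with $P$ is $$C_P=\{(xG_j)_{j:\,\langle G_j\rangle\ne P}:x\in p^\perp\},$$ where $p^\perp=\{x\in\mathbb{F}_q^k: x\cdot p=0\}$ (row vectors $x$, standard dot product); this includes the case $\mathcal{M}_C(P)=0$. *)

theory Defs
  imports "Jordan_Normal_Form.DL_Rank" "HOL-Library.Cardinality"
begin

text \<open>
  The field with \<open>q\<close> elements is a type \<open>'a :: {field, finite}\<close> with \<open>q = CARD('a)\<close>; the space of
  vectors of length \<open>n\<close> over it is \<open>carrier_vec n\<close>. Coordinates are numbered from 0.
\<close>

definition linear_code :: "nat \<Rightarrow> nat \<Rightarrow> 'a :: {field, finite} vec set \<Rightarrow> bool" where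
  "linear_code n k C \<longleftrightarrow>
     VectorSpace.subspace class_ring C (module_vec TYPE('a) n) \<and>
     vectorspace.dim class_ring (module_vec TYPE('a) n \<lparr>carrier := C\<rparr>) = k"

definition subcodes :: "nat \<Rightarrow> nat \<Rightarrow> 'a :: {field, finite} vec set \<Rightarrow> 'a vec set set" where
  "subcodes n r C = {A. A \<subseteq> C \<and> linear_code n r A}"

definition supp :: "nat \<Rightarrow> 'a :: {field, finite} vec set \<Rightarrow> nat set" where
  "supp n A = {j. j < n \<and> (\<exists>a\<in>A. a $ j \<noteq> 0)}"

definition weight :: "nat \<Rightarrow> 'a :: {field, finite} vec set \<Rightarrow> nat" where
  "weight n A = card (supp n A)"

text \<open>The weight of the code itself is its effective length.\<close>

abbreviation eff_length :: "nat \<Rightarrow> 'a :: {field, finite} vec set \<Rightarrow> nat" where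
  "eff_length n C \<equiv> weight n C"

definition full_length_code :: "nat \<Rightarrow> nat \<Rightarrow> 'a :: {field, finite} vec set \<Rightarrow> bool" where
  "full_length_code n k C \<longleftrightarrow> linear_code n k C \<and> eff_length n C = n"

text \<open>
  The \<open>r\<close>-th minimum and maximum subcode weights. They are meaningful only if \<open>C\<close> has a subcode of
  dimension \<open>r\<close>, that is, if \<open>r\<close> is at most the dimension of \<open>C\<close>.
\<close>

definition min_subcode_weight :: "nat \<Rightarrow> nat \<Rightarrow> 'a :: {field, finite} vec set \<Rightarrow> nat" where
  "min_subcode_weight n r C = Min (weight n ` subcodes n r C)"

definition max_subcode_weight :: "nat \<Rightarrow> nat \<Rightarrow> 'a :: {field, finite} vec set \<Rightarrow> nat" where
  "max_subcode_weight n r C = Max (weight n ` subcodes n r C)"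

definition q_number :: "nat \<Rightarrow> nat \<Rightarrow> real" where
  "q_number q r = (real q ^ r - 1) / (real q - 1)"

definition griesmer_fn :: "nat \<Rightarrow> nat \<Rightarrow> nat \<Rightarrow> nat \<Rightarrow> int" where
  "griesmer_fn q r k x = int x + (\<Sum>i = 1..k - r. \<lceil>real x / (real q ^ i * q_number q r)\<rceil>)"

definition antigriesmer_fn :: "nat \<Rightarrow> nat \<Rightarrow> nat \<Rightarrow> nat \<Rightarrow> int" where
  "antigriesmer_fn q r k x = int x + (\<Sum>i = 1..k - r. \<lfloor>real x / (real q ^ i * q_number q r)\<rfloor>)"

definition griesmer_code :: "nat \<Rightarrow> nat \<Rightarrow> nat \<Rightarrow> 'a :: {field, finite} vec set \<Rightarrow> bool" where
  "griesmer_code r n k C \<longleftrightarrow>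
     full_length_code n k C \<and> 1 \<le> r \<and> r \<le> k \<and>
     int n = griesmer_fn CARD('a) r k (min_subcode_weight n r C)"

definition antigriesmer_code :: "nat \<Rightarrow> nat \<Rightarrow> nat \<Rightarrow> 'a :: {field, finite} vec set \<Rightarrow> bool" where
  "antigriesmer_code r n k C \<longleftrightarrow>
     full_length_code n k C \<and> 1 \<le> r \<and> r \<le> k \<and>
     int n = antigriesmer_fn CARD('a) r k (max_subcode_weight n r C)"

text \<open>The rows of \<open>G\<close> form a basis of \<open>C\<close>.\<close>

definition generator_matrix ::
    "nat \<Rightarrow> nat \<Rightarrow> 'a :: {field, finite} mat \<Rightarrow> 'a vec set \<Rightarrow> bool" where
  "generator_matrix k n G C \<longleftrightarrow>
     G \<in> carrier_mat k n \<and> distinct (rows G) \<and>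
     module.lin_indpt class_ring (module_vec TYPE('a) n) (set (rows G)) \<and>
     vec_space.row_space n G = C"

text \<open>The points of the projective space of dimension \<open>k - 1\<close>.\<close>

definition proj_points :: "nat \<Rightarrow> 'a :: {field, finite} vec set set" where
  "proj_points k = {P. linear_code k 1 P}"

definition line_of :: "nat \<Rightarrow> 'a :: {field, finite} vec \<Rightarrow> 'a vec set" where
  "line_of k v = LinearCombinations.module.span class_ring (module_vec TYPE('a) k) {v}"

definition point_mult :: "'a :: {field, finite} mat \<Rightarrow> 'a vec set \<Rightarrow> nat" where
  "point_mult G P = card {j. j < dim_col G \<and> line_of (dim_row G) (col G j) = P}"

definition max_point :: "'a :: {field, finite} mat \<Rightarrow> 'a vec set \<Rightarrow> bool" where
  "max_point G P \<longleftrightarrow> P \<in> proj_points (dim_row G) \<and>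
     (\<forall>Q \<in> proj_points (dim_row G). point_mult G Q \<le> point_mult G P)"

definition min_point :: "'a :: {field, finite} mat \<Rightarrow> 'a vec set \<Rightarrow> bool" where
  "min_point G P \<longleftrightarrow> P \<in> proj_points (dim_row G) \<and>
     (\<forall>Q \<in> proj_points (dim_row G). point_mult G P \<le> point_mult G Q)"

text \<open>
  The coordinates that remain after shortening at the point spanned by \<open>p\<close>, in increasing order;
  the shortened subcode is re-indexed along this list.
\<close>

definition kept_coords :: "'a :: {field, finite} mat \<Rightarrow> 'a vec \<Rightarrow> nat list" where
  "kept_coords G p =
     filter (\<lambda>j. line_of (dim_row G) (col G j) \<noteq> line_of (dim_row G) p) [0..<dim_col G]"

definition shortened_length :: "'a :: {field, finite} mat \<Rightarrow> 'a vec \<Rightarrow> nat" where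
  "shortened_length G p = length (kept_coords G p)"

definition shortened_subcode :: "'a :: {field, finite} mat \<Rightarrow> 'a vec \<Rightarrow> 'a vec set" where
  "shortened_subcode G p =
     {vec_of_list (map (\<lambda>j. x \<bullet> col G j) (kept_coords G p)) | x.
        x \<in> carrier_vec (dim_row G) \<and> x \<bullet> p = 0}"

end

theory Submission
  imports Defs "Berlekamp_Zassenhaus.Berlekamp_Type_Based"
begin

text \<open>
  A vector \<open>p \<noteq> 0\<close> cuts out a hyperplane subcode \<open>H\<^sub>p = {xG | x \<bottom> p}\<close> of \<open>C\<close>. Its weight is
  \<open>n(C) - \<M>\<^sub>C(\<langle>p\<rangle>)\<close>, and deleting its zero coordinates gives the shortened code. Summing over
  all \<open>p \<noteq> 0\<close> counts every nonzero column of \<open>G\<close> exactly \<open>q - 1\<close> times, so the average of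
  \<open>\<M>\<^sub>C\<close> over the points is \<open>n(C) / [k]\<^sub>q\<close>.

  If all \<open>H\<^sub>p\<close> satisfy the generalized Griesmer bound \<open>g(k - 1, d)\<close>, then all multiplicities are at
  most \<open>n(C) - g(k - 1, d)\<close>; comparing this with the average gives the bound \<open>g(k, d)\<close> for \<open>C\<close>.
  In the case of equality, the average forces the maximum multiplicity to be at least
  \<open>\<lceil>d / (q^(k - r) [r]\<^sub>q)\<rceil>\<close>, and the bound for \<open>H\<^sub>p\<close> forces it to be at most that number. Strict
  monotonicity of \<open>g(k - 1, \<cdot>)\<close> then determines the minimum subcode weight of \<open>H\<^sub>p\<close>. The
  antiGriesmer case is the same with all inequalities reversed.
\<close>

subsection \<open>Codes and their generator matrices\<close>

text \<open>Over a finite field the dimension of a subspace is determined by its cardinality; all dimension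
  arguments below are carried out by counting vectors.\<close>

definition vec_subspace :: "nat \<Rightarrow> 'a :: semiring_1 vec set \<Rightarrow> bool" where
  "vec_subspace n U \<longleftrightarrow>
     U \<subseteq> carrier_vec n \<and> 0\<^sub>v n \<in> U \<and> (\<forall>u\<in>U. \<forall>v\<in>U. u + v \<in> U) \<and> (\<forall>c. \<forall>v\<in>U. c \<cdot>\<^sub>v v \<in> U)"

lemma vec_subspaceI:
  assumes "U \<subseteq> carrier_vec n" "0\<^sub>v n \<in> U" "\<And>u v. u \<in> U \<Longrightarrow> v \<in> U \<Longrightarrow> u + v \<in> U"
    "\<And>c v. v \<in> U \<Longrightarrow> c \<cdot>\<^sub>v v \<in> U"
  shows "vec_subspace n U"
  using assms by (auto simp: vec_subspace_def)

lemma vec_subspaceD: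
  assumes "vec_subspace n U"
  shows "U \<subseteq> carrier_vec n" "0\<^sub>v n \<in> U" "u \<in> U \<Longrightarrow> v \<in> U \<Longrightarrow> u + v \<in> U" "v \<in> U \<Longrightarrow> c \<cdot>\<^sub>v v \<in> U"
  using assms by (auto simp: vec_subspace_def)

lemma subspace_module_vec_iff:
  "VectorSpace.subspace class_ring U (module_vec TYPE('a :: field) n) \<longleftrightarrow> vec_subspace n U"
proof -
  interpret vec_space "TYPE('a)" n .
  show ?thesis
    using vectorspace_axioms module_axioms
    by (auto simp: VectorSpace.subspace_def submodule_def vec_subspace_def)
qed

lemma finite_vec_subspace:
  fixes U :: "'a :: {field, finite} vec set"
  assumes "vec_subspace n U"
  shows "finite U"
  using vec_subspaceD(1)[OF assms] finite_carrier_vec finite_subset by blast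

text \<open>This supplies both forms in which dimension is used: a spanning set of the right size,
  for building matrices, and a cardinality, for counting.\<close>

lemma vec_subspace_basis:
  fixes U :: "'a :: {field, finite} vec set"
  assumes U: "vec_subspace n U"
  defines "d \<equiv> vectorspace.dim class_ring (module_vec TYPE('a) n \<lparr>carrier := U\<rparr>)"
  obtains B where "finite B" "card B = d" "B \<subseteq> carrier_vec n" "LinearCombinations.module.span class_ring (module_vec TYPE('a) n) B = U"
    and "card U = CARD('a) ^ d"
proof -
  interpret V: vec_space "TYPE('a)" n .
  have sub: "VectorSpace.subspace class_ring U V.V" using U subspace_module_vec_iff by blast
  then have subm: "submodule class_ring U V.V" by (simp add: VectorSpace.subspace_def)
  interpret W: vectorspace class_ring "V.vs U" by (rule V.subspace_is_vs[OF sub])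
  have "W.span U = U"
    using W.in_own_span[of U] W.span_is_subset2[of U] by auto
  \<comment> \<open>The finite set \<open>U\<close> serves as its own spanning set.\<close>
  then have "W.fin_dim"
    unfolding W.fin_dim_def using finite_vec_subspace[OF U] by (auto intro!: exI[of _ U])
  then obtain B where B: "finite B" "W.basis B" using W.finite_basis_exists by blast
  have BU: "B \<subseteq> U" using B(2) by (simp add: W.basis_def)
  have card: "card B = d" using W.dim_basis[OF B] by (simp add: d_def)
  have "V.span B = U"
    using B(2) V.span_li_not_depend(1)[OF BU subm] by (simp add: W.basis_def)
  \<comment> \<open>Each vector of \<open>U\<close> has a unique coordinate function on
    \<open>B\<close>; extensional functions make that uniqueness literal, so counting them counts
    \<open>U\<close>.\<close>
  moreover have "bij_betw (\<lambda>a. W.lincomb a B) (B \<rightarrow>\<^sub>E (UNIV :: 'a set)) U"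
  proof -
    have ex1: "\<exists>!a. a \<in> B \<rightarrow>\<^sub>E (UNIV :: 'a set) \<and> W.lincomb a B = v" if "v \<in> U" for v
      using W.basis_criterion[OF B(1)] B(2) BU that by simp
    have closed: "W.lincomb a B \<in> U" for a
      using W.lincomb_closed[of B a] BU by simp
    show ?thesis
    proof (intro bij_betwI')
      fix a b assume "a \<in> B \<rightarrow>\<^sub>E (UNIV :: 'a set)" "b \<in> B \<rightarrow>\<^sub>E (UNIV :: 'a set)"
      then show "W.lincomb a B = W.lincomb b B \<longleftrightarrow> a = b" using ex1[OF closed] by metis
    next
      fix v assume "v \<in> U"
      from ex1[OF this] show "\<exists>a\<in>B \<rightarrow>\<^sub>E UNIV. v = W.lincomb a B" by metis
    qed (rule closed)
  qed
  then have "card U = card (B \<rightarrow>\<^sub>E (UNIV :: 'a set))" by (simp add: bij_betw_same_card)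
  then have "card U = CARD('a) ^ d"
    by (simp add: card_PiE[OF B(1)] card)
  ultimately show ?thesis using that B(1) card BU vec_subspaceD(1)[OF U] by blast
qed

lemma card_ge_2: "CARD('a :: {field, finite}) \<ge> 2"
  using card_mono[of "UNIV :: 'a set" "{0, 1}"] by simp

text \<open>Since q is at least 2, the exponent can be read off from the number of
  codewords.\<close>

lemma linear_code_iff_card:
  fixes C :: "'a :: {field, finite} vec set"
  shows "linear_code n k C \<longleftrightarrow> vec_subspace n C \<and> card C = CARD('a) ^ k"
proof (cases "vec_subspace n C")
  case True
  from vec_subspace_basis[OF this]
  have "card C = CARD('a) ^ vectorspace.dim class_ring (module_vec TYPE('a) n \<lparr>carrier := C\<rparr>)"
    by blast
  with True show ?thesis
    using card_ge_2[where 'a='a] by (simp add: linear_code_def subspace_module_vec_iff)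
qed (simp add: linear_code_def subspace_module_vec_iff)

lemma vec_subspace_multiples:
  fixes v :: "'a :: field vec"
  assumes "v \<in> carrier_vec k"
  shows "vec_subspace k (range (\<lambda>c. c \<cdot>\<^sub>v v))" (is "vec_subspace k ?L")
proof (rule vec_subspaceI)
  have "0\<^sub>v k = 0 \<cdot>\<^sub>v v" using assms by auto
  then show "0\<^sub>v k \<in> ?L" by blast
qed (use assms in \<open>auto simp: add_smult_distrib_vec[symmetric] smult_smult_assoc\<close>)

lemma line_of_eq:
  assumes "v \<in> carrier_vec k"
  shows "line_of k v = range (\<lambda>c. c \<cdot>\<^sub>v v)"
proof -
  interpret V: vec_space "TYPE('a)" k .
  let ?L = "range (\<lambda>c. c \<cdot>\<^sub>v v)"
  have sub: "submodule class_ring ?L V.V"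
    using vec_subspace_multiples[OF assms] subspace_module_vec_iff by (auto simp: VectorSpace.subspace_def)
  have "v = 1 \<cdot>\<^sub>v v" by simp
  then have "V.span {v} \<subseteq> ?L" using V.span_is_subset[OF _ sub, of "{v}"] by blast
  moreover have "?L \<subseteq> V.span {v}"
    using V.span_is_submodule[of "{v}"] V.span_self[of v] assms
    by (auto intro: submodule.smult_closed)
  ultimately have "V.span {v} = ?L" by blast
  then show ?thesis by (simp add: line_of_def)
qed

text \<open>This is the row vector product xG, given entrywise to match the entries in
  \<open>shortened_subcode\<close>.\<close>

definition encode :: "'a :: comm_ring_1 mat \<Rightarrow> 'a vec \<Rightarrow> 'a vec" where
  "encode G x = vec (dim_col G) (\<lambda>j. x \<bullet> col G j)"

lemma encode_simps [simp]:
  "dim_vec (encode G x) = dim_col G"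
  "j < dim_col G \<Longrightarrow> encode G x $ j = x \<bullet> col G j"
  by (auto simp: encode_def)

lemma encode_add:
  assumes "G \<in> carrier_mat k n" "x \<in> carrier_vec k" "y \<in> carrier_vec k"
  shows "encode G (x + y) = encode G x + encode G y"
  using assms by (intro eq_vecI) (auto intro!: add_scalar_prod_distrib)

lemma encode_smult:
  assumes "G \<in> carrier_mat k n" "x \<in> carrier_vec k"
  shows "encode G (c \<cdot>\<^sub>v x) = c \<cdot>\<^sub>v encode G x"
  using assms by (intro eq_vecI) auto

lemma encode_eq_mult:
  assumes "G \<in> carrier_mat k n" "x \<in> carrier_vec k"
  shows "encode G x = G\<^sup>T *\<^sub>v x"
  using assms by (intro eq_vecI) (auto intro!: comm_scalar_prod)

lemma encode_row_space:
  assumes "G \<in> carrier_mat k n"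
  shows "vec_space.row_space n G = encode G ` carrier_vec k"
  using assms encode_eq_mult[OF assms] by (auto simp: vec_space.row_space_eq image_iff)

text \<open>The induction meets codes that come without a matrix. A basis, listed as rows, provides
  one; injectivity of \<open>encode\<close> is the form of row independence used later.\<close>

lemma linear_code_encoder:
  fixes C :: "'a :: {field, finite} vec set"
  assumes "linear_code n k C"
  obtains G where "G \<in> carrier_mat k n" "inj_on (encode G) (carrier_vec k)"
    "C = encode G ` carrier_vec k"
proof -
  interpret V: vec_space "TYPE('a)" n .
  from assms have C: "vec_subspace n C" "card C = CARD('a) ^ k"
    by (simp_all add: linear_code_iff_card)
  have dim: "vectorspace.dim class_ring (module_vec TYPE('a) n \<lparr>carrier := C\<rparr>) = k"
    using assms by (simp add: linear_code_def)
  obtain B where B: "finite B" "card B = k" "B \<subseteq> carrier_vec n" "V.span B = C"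
    using vec_subspace_basis[OF C(1)] dim by metis
  obtain bs where bs: "set bs = B" "length bs = k"
    using B(1,2) finite_distinct_list distinct_card by metis
  define G where "G = mat_of_rows n bs"
  have G: "G \<in> carrier_mat k n" by (auto simp: G_def bs)
  have "C = V.row_space G"
    using B bs by (simp add: V.row_space_def G_def)
  then have C_eq: "C = encode G ` carrier_vec k" using encode_row_space[OF G] by simp
  \<comment> \<open>Message space and code both have q^k elements, so the surjection is
    injective.\<close>
  have "inj_on (encode G) (carrier_vec k)"
    using C(2) C_eq card_carrier_vec[where 'b='a] by (intro eq_card_imp_inj_on) auto
  with that G C_eq show ?thesis by blast
qed

subsection \<open>Hyperplane subcodes\<close>

text \<open>The shortened code before its zero coordinates are deleted.\<close>

definition hyperplane_code :: "'a :: comm_ring_1 mat \<Rightarrow> 'a vec \<Rightarrow> 'a vec set" where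
  "hyperplane_code G p = encode G ` {x \<in> carrier_vec (dim_row G). x \<bullet> p = 0}"

text \<open>The coordinates counted by \<open>\<M>\<^sub>C(\<langle>p\<rangle>)\<close>; zero columns occur in the generator
  matrices of hyperplane subcodes and have to be excluded explicitly.\<close>

definition dir_coords :: "'a :: comm_ring_1 mat \<Rightarrow> 'a vec \<Rightarrow> nat set" where
  "dir_coords G p = {j. j < dim_col G \<and> col G j \<noteq> 0\<^sub>v (dim_row G) \<and> (\<exists>c. col G j = c \<cdot>\<^sub>v p)}"

lemma encode_zero:
  assumes "G \<in> carrier_mat k n"
  shows "encode G (0\<^sub>v k) = 0\<^sub>v n"
  using assms by (intro eq_vecI) auto

lemma vec_subspace_encode_image:
  assumes G: "G \<in> carrier_mat k n" and U: "vec_subspace k U"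
  shows "vec_subspace n (encode G ` U)"
proof (rule vec_subspaceI)
  note U' = vec_subspaceD[OF U]
  show "encode G ` U \<subseteq> carrier_vec n" using G by (auto intro!: carrier_vecI)
  show "0\<^sub>v n \<in> encode G ` U" using encode_zero[OF G] U'(2) by (metis imageI)
  fix u v assume "u \<in> encode G ` U" "v \<in> encode G ` U"
  then obtain x y where "x \<in> U" "y \<in> U" "u = encode G x" "v = encode G y" by blast
  moreover from this have "u + v = encode G (x + y)"
    using encode_add[OF G] U'(1) by (simp add: subset_iff)
  ultimately show "u + v \<in> encode G ` U" using U'(3) by blast
next
  note U' = vec_subspaceD[OF U]
  fix c v assume "v \<in> encode G ` U"
  then obtain x where "x \<in> U" "v = encode G x" by blast
  moreover from this have "c \<cdot>\<^sub>v v = encode G (c \<cdot>\<^sub>v x)"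
    using encode_smult[OF G] U'(1) by (simp add: subset_iff)
  ultimately show "c \<cdot>\<^sub>v v \<in> encode G ` U" using U'(4) by blast
qed

lemma col_carrier: "G \<in> carrier_mat k n \<Longrightarrow> col G j \<in> carrier_vec k"
  by (metis carrier_matD(1) col_dim)

section \<open>Orthogonal complements of vectors\<close>

lemma vec_subspace_orthogonal:
  assumes p: "(p :: 'a :: comm_ring_1 vec) \<in> carrier_vec k"
  shows "vec_subspace k {x \<in> carrier_vec k. x \<bullet> p = 0}"
  using p by (intro vec_subspaceI) (auto simp: add_scalar_prod_distrib)

lemma ex_nonzero_entry:
  assumes "p \<in> carrier_vec k" "p \<noteq> 0\<^sub>v k"
  obtains i where "i < k" "p $ i \<noteq> 0"
  using assms by (metis carrier_vecD eq_vecI index_zero_vec)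

lemma ex_scalar_prod_1:
  fixes p :: "'a :: field vec"
  assumes p: "p \<in> carrier_vec k" "p \<noteq> 0\<^sub>v k"
  obtains x where "x \<in> carrier_vec k" "x \<bullet> p = 1"
proof -
  obtain i where i: "i < k" "p $ i \<noteq> 0" using ex_nonzero_entry[OF p] .
  show ?thesis
    using i p by (intro that[of "(1 / p $ i) \<cdot>\<^sub>v unit_vec k i"]) auto
qed

text \<open>A vector \<open>e\<close> with e.p = 1 splits the whole space into the line of
  \<open>e\<close> and the complement of \<open>p\<close>, so q times the wanted number is
  q^(k+1).\<close>

lemma card_orthogonal:
  fixes p :: "'a :: {field, finite} vec"
  assumes p: "p \<in> carrier_vec (Suc k)" "p \<noteq> 0\<^sub>v (Suc k)"
  shows "card {x \<in> carrier_vec (Suc k). x \<bullet> p = 0} = CARD('a) ^ k"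
proof -
  let ?H = "{x \<in> carrier_vec (Suc k). x \<bullet> p = 0}"
  obtain e where e: "e \<in> carrier_vec (Suc k)" "e \<bullet> p = 1" using ex_scalar_prod_1[OF p] .
  let ?f = "\<lambda>(c :: 'a, x). c \<cdot>\<^sub>v e + x" and ?g = "\<lambda>y. (y \<bullet> p, y - (y \<bullet> p) \<cdot>\<^sub>v e)"
  have "bij_betw ?f (UNIV \<times> ?H) (carrier_vec (Suc k))"
  proof (intro bij_betw_byWitness[where f' = ?g] ballI)
    fix a assume "a \<in> (UNIV :: 'a set) \<times> ?H"
    then obtain c x where x: "x \<in> carrier_vec (Suc k)" "x \<bullet> p = 0" and a: "a = (c, x)" by auto
    have "(c \<cdot>\<^sub>v e + x) \<bullet> p = c"
      using e p x by (simp add: add_scalar_prod_distrib[where n = "Suc k"])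
    moreover have "c \<cdot>\<^sub>v e + x - c \<cdot>\<^sub>v e = x"
      using e x by (intro eq_vecI) auto
    ultimately show "?g (?f a) = a" by (simp add: a)
  next
    fix y :: "'a vec" assume "y \<in> carrier_vec (Suc k)"
    then show "?f (?g y) = y" using e by (auto intro!: eq_vecI)
  next
    show "?f ` (UNIV \<times> ?H) \<subseteq> carrier_vec (Suc k)" using e by auto
    show "?g ` carrier_vec (Suc k) \<subseteq> UNIV \<times> ?H"
      using e p by (auto simp: minus_scalar_prod_distrib[where n = "Suc k"])
  qed
  then have "card (UNIV \<times> ?H :: ('a \<times> 'a vec) set) = card (carrier_vec (Suc k) :: 'a vec set)"
    by (rule bij_betw_same_card)
  then have "CARD('a) * card ?H = CARD('a) ^ Suc k"
    by (simp add: card_cartesian_product card_carrier_vec)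
  then show ?thesis using card_ge_2[where 'a='a] by simp
qed

text \<open>The double orthogonal complement of a line is the line itself. This turns vanishing of a
  coordinate on a hyperplane subcode into a condition on its column.\<close>

lemma orthogonal_subset_imp_multiple:
  fixes p g :: "'a :: field vec"
  assumes p: "p \<in> carrier_vec k" "p \<noteq> 0\<^sub>v k" and g: "g \<in> carrier_vec k"
    and orth: "\<And>x. x \<in> carrier_vec k \<Longrightarrow> x \<bullet> p = 0 \<Longrightarrow> x \<bullet> g = 0"
  shows "\<exists>c. g = c \<cdot>\<^sub>v p"
proof -
  obtain e where e: "e \<in> carrier_vec k" "e \<bullet> p = 1" using ex_scalar_prod_1[OF p] .
  \<comment> \<open>The factor is forced: pairing g = cp with \<open>e\<close> gives c, as e.p =
    1.\<close>
  have "g = (e \<bullet> g) \<cdot>\<^sub>v p"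
  proof (intro eq_vecI)
    fix i assume "i < dim_vec ((e \<bullet> g) \<cdot>\<^sub>v p)"
    then have i: "i < k" using p by simp
    \<comment> \<open>The unit vector is moved along \<open>e\<close> into the complement of
      \<open>p\<close>; orthogonality to \<open>g\<close> then gives the i-th entry of
      \<open>g\<close>.\<close>
    let ?x = "unit_vec k i - p $ i \<cdot>\<^sub>v e"
    have "?x \<bullet> p = 0"
      using e p i by (simp add: minus_scalar_prod_distrib[where n = k])
    then have "?x \<bullet> g = 0" using e by (intro orth) auto
    then show "g $ i = ((e \<bullet> g) \<cdot>\<^sub>v p) $ i"
      using e p i g by (simp add: minus_scalar_prod_distrib[where n = k] mult.commute)
  qed (use p g in auto)
  then show ?thesis ..
qed

lemma supp_encode:
  fixes G :: "'a :: {field, finite} mat"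
  assumes G: "G \<in> carrier_mat k n"
  shows "supp n (encode G ` carrier_vec k) = {j. j < n \<and> col G j \<noteq> 0\<^sub>v k}"
proof -
  have "(\<exists>x\<in>carrier_vec k. x \<bullet> col G j \<noteq> 0) \<longleftrightarrow> col G j \<noteq> 0\<^sub>v k" if "j < n" for j
  proof
    assume "col G j \<noteq> 0\<^sub>v k"
    then obtain x where "x \<in> carrier_vec k" "x \<bullet> col G j = 1"
      using ex_scalar_prod_1[OF col_carrier[OF G]] by blast
    then show "\<exists>x\<in>carrier_vec k. x \<bullet> col G j \<noteq> 0" by (intro bexI[of _ x]) auto
  qed auto
  then show ?thesis using G by (auto simp: supp_def)
qed

lemma supp_hyperplane_code:
  fixes G :: "'a :: {field, finite} mat"
  assumes G: "G \<in> carrier_mat k n" and p: "p \<in> carrier_vec k" "p \<noteq> 0\<^sub>v k"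
  shows "supp n (hyperplane_code G p) = {j. j < n \<and> \<not> (\<exists>c. col G j = c \<cdot>\<^sub>v p)}"
proof -
  have "(\<exists>x\<in>carrier_vec k. x \<bullet> p = 0 \<and> x \<bullet> col G j \<noteq> 0) \<longleftrightarrow> \<not> (\<exists>c. col G j = c \<cdot>\<^sub>v p)"
    if "j < n" for j
    using orthogonal_subset_imp_multiple[OF p col_carrier[OF G], of j] p by auto
  moreover have "j \<in> supp n (hyperplane_code G p) \<longleftrightarrow>
      j < n \<and> (\<exists>x\<in>carrier_vec k. x \<bullet> p = 0 \<and> x \<bullet> col G j \<noteq> 0)" for j
    using G by (auto simp: supp_def hyperplane_code_def)
  ultimately show ?thesis by blast
qed

text \<open>Restricting to the complement of \<open>p\<close> kills exactly those coordinates of the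
  support whose column lies on the line of \<open>p\<close>.\<close>

lemma weight_encode_eq:
  fixes G :: "'a :: {field, finite} mat"
  assumes G: "G \<in> carrier_mat k n" and p: "p \<in> carrier_vec k" "p \<noteq> 0\<^sub>v k"
  shows "weight n (encode G ` carrier_vec k) = weight n (hyperplane_code G p) + card (dir_coords G p)"
proof -
  \<comment> \<open>Zero columns are also multiples of \<open>p\<close>, hence lie in neither
    support.\<close>
  have zero: "0\<^sub>v k = 0 \<cdot>\<^sub>v p" using p by auto
  have "supp n (encode G ` carrier_vec k) = supp n (hyperplane_code G p) \<union> dir_coords G p"
    unfolding supp_encode[OF G] supp_hyperplane_code[OF G p] dir_coords_def
    using G zero by auto
  moreover have "supp n (hyperplane_code G p) \<inter> dir_coords G p = {}"
    unfolding supp_hyperplane_code[OF G p] dir_coords_def by auto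
  moreover have "finite (dir_coords G p)" by (simp add: dir_coords_def)
  moreover have "finite (supp n (hyperplane_code G p))" by (simp add: supp_def)
  ultimately show ?thesis by (simp add: weight_def card_Un_disjoint)
qed

lemma linear_code_hyperplane_code:
  fixes G :: "'a :: {field, finite} mat"
  assumes G: "G \<in> carrier_mat (Suc k) n" "inj_on (encode G) (carrier_vec (Suc k))"
    and p: "p \<in> carrier_vec (Suc k)" "p \<noteq> 0\<^sub>v (Suc k)"
  shows "linear_code n k (hyperplane_code G p)"
proof -
  let ?H = "{x \<in> carrier_vec (Suc k). x \<bullet> p = 0}"
  have H: "hyperplane_code G p = encode G ` ?H" using G(1) by (auto simp: hyperplane_code_def)
  have "card (encode G ` ?H) = card ?H"
    by (rule card_image) (use G(2) in \<open>auto intro: inj_on_subset\<close>)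
  then show ?thesis
    using vec_subspace_encode_image[OF G(1) vec_subspace_orthogonal[OF p(1)]] card_orthogonal[OF p]
    by (simp add: H linear_code_iff_card)
qed

section \<open>Double counting of columns over directions\<close>

lemma card_multiple_directions:
  fixes g :: "'a :: {field, finite} vec"
  assumes g: "g \<in> carrier_vec k" "g \<noteq> 0\<^sub>v k"
  shows "card {p \<in> carrier_vec k - {0\<^sub>v k}. \<exists>c. g = c \<cdot>\<^sub>v p} = CARD('a) - 1"
proof -
  obtain i where i: "i < k" "g $ i \<noteq> 0" using ex_nonzero_entry[OF g] .
  have "inj_on (\<lambda>c. c \<cdot>\<^sub>v g) (UNIV - {0})"
  proof (rule inj_onI)
    fix c d assume "c \<cdot>\<^sub>v g = d \<cdot>\<^sub>v g"
    then have "(c \<cdot>\<^sub>v g) $ i = (d \<cdot>\<^sub>v g) $ i" by simp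
    then show "c = d" using i g by simp
  qed
  \<comment> \<open>Because \<open>g\<close> is nonzero the factor is invertible, so the vectors in
    question are the nonzero multiples of \<open>g\<close>.\<close>
  moreover have "{p \<in> carrier_vec k - {0\<^sub>v k}. \<exists>c. g = c \<cdot>\<^sub>v p} = (\<lambda>c. c \<cdot>\<^sub>v g) ` (UNIV - {0})" (is "?L = ?R")
  proof
    show "?L \<subseteq> ?R"
    proof
      fix p assume "p \<in> ?L"
      then obtain c where c: "p \<in> carrier_vec k" "g = c \<cdot>\<^sub>v p" by auto
      then have "c \<noteq> 0" using g by auto
      then have "p = (1 / c) \<cdot>\<^sub>v g" using c by (simp add: smult_smult_assoc)
      with \<open>c \<noteq> 0\<close> show "p \<in> ?R" by auto
    qed
    show "?R \<subseteq> ?L"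
    proof
      fix p assume "p \<in> ?R"
      then obtain c where c: "c \<noteq> 0" "p = c \<cdot>\<^sub>v g" by auto
      then have "g = (1 / c) \<cdot>\<^sub>v p" by (simp add: smult_smult_assoc)
      moreover from this have "p \<noteq> 0\<^sub>v k" using g by auto
      ultimately show "p \<in> ?L" using c g by auto
    qed
  qed
  ultimately show ?thesis by (simp add: card_image)
qed

text \<open>Pairs of a direction and a coordinate are counted in two ways. Summing over nonzero
  vectors counts every point q - 1 times and avoids choosing representatives.\<close>

lemma sum_card_dir_coords:
  fixes G :: "'a :: {field, finite} mat"
  assumes G: "G \<in> carrier_mat k n"
  shows "(\<Sum>p\<in>carrier_vec k - {0\<^sub>v k}. card (dir_coords G p)) =
    (CARD('a) - 1) * weight n (encode G ` carrier_vec k)"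
proof -
  let ?P = "carrier_vec k - {0\<^sub>v k} :: 'a vec set" and ?S = "{j. j < n \<and> col G j \<noteq> 0\<^sub>v k}"
  have "dir_coords G p = {j \<in> ?S. \<exists>c. col G j = c \<cdot>\<^sub>v p}" for p
    using G by (auto simp: dir_coords_def)
  then have "(\<Sum>p\<in>?P. card (dir_coords G p)) = (\<Sum>p\<in>?P. card {j \<in> ?S. \<exists>c. col G j = c \<cdot>\<^sub>v p})"
    by simp
  also have "\<dots> = (CARD('a) - 1) * card ?S"
  proof (rule sum_multicount)
    show "\<forall>j\<in>?S. card {p \<in> ?P. \<exists>c. col G j = c \<cdot>\<^sub>v p} = CARD('a) - 1"
      using card_multiple_directions[OF col_carrier[OF G]] by blast
  qed auto
  finally show ?thesis by (simp add: weight_def supp_encode[OF G])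
qed

lemma card_nonzero_vectors:
  "card (carrier_vec k - {0\<^sub>v k} :: 'a :: {field, finite} vec set) = CARD('a) ^ k - 1"
  by (simp add: card_Diff_singleton card_carrier_vec)

section \<open>Existence and finiteness of subcodes\<close>

lemma subcodes_mono: "A \<subseteq> B \<Longrightarrow> subcodes n r A \<subseteq> subcodes n r B"
  by (auto simp: subcodes_def)

lemma subcodes_self: "linear_code n k C \<Longrightarrow> subcodes n k C = {C}"
proof -
  assume C: "linear_code n k C"
  then have "A = C" if "A \<subseteq> C" "linear_code n k A" for A
    using that C finite_vec_subspace[of n C] by (simp add: linear_code_iff_card card_subset_eq)
  with C show ?thesis by (auto simp: subcodes_def)
qed

text \<open>Repeated passage to a hyperplane subcode lowers the dimension to \<open>r\<close>. This
  ensures that the minimum and maximum weights are attained.\<close>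

lemma subcodes_nonempty:
  fixes C :: "'a :: {field, finite} vec set"
  assumes "linear_code n k C" "r \<le> k"
  shows "subcodes n r C \<noteq> {}"
  using assms(2,1)
proof (induction k arbitrary: C rule: dec_induct)
  case base
  then show ?case by (simp add: subcodes_self)
next
  case (step k)
  obtain G where G: "G \<in> carrier_mat (Suc k) n" "inj_on (encode G) (carrier_vec (Suc k))"
    "C = encode G ` carrier_vec (Suc k)"
    using linear_code_encoder[OF step.prems] .
  \<comment> \<open>Any nonzero vector would serve.\<close>
  let ?p = "unit_vec (Suc k) 0"
  have p: "?p \<in> carrier_vec (Suc k)" "?p \<noteq> 0\<^sub>v (Suc k)" by auto
  have "hyperplane_code G ?p \<subseteq> C" using G by (auto simp: hyperplane_code_def)
  then show ?case
    using step.IH[OF linear_code_hyperplane_code[OF G(1,2) p]] subcodes_mono by blast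
qed

lemma finite_subcodes [simp]: "finite (subcodes n r (C :: 'a :: {field, finite} vec set))"
proof (rule finite_subset)
  show "subcodes n r C \<subseteq> Pow (carrier_vec n)"
    by (auto simp: subcodes_def linear_code_iff_card dest: vec_subspaceD(1))
qed simp

subsection \<open>The generalized Griesmer and antiGriesmer bounds\<close>

lemma q_number_Suc: "q \<ge> 2 \<Longrightarrow> q_number q (Suc k) = real q * q_number q k + 1"
  by (simp add: q_number_def field_simps)

lemma q_number_pos: "q \<ge> 2 \<Longrightarrow> k \<ge> 1 \<Longrightarrow> q_number q k > 0"
  by (simp add: q_number_def)

lemma q_number_nonneg: "q \<ge> 2 \<Longrightarrow> q_number q k \<ge> 0"
  by (simp add: q_number_def)

lemma q_number_mult: "q \<ge> 2 \<Longrightarrow> (real q - 1) * q_number q k = real q ^ k - 1"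
  by (simp add: q_number_def)

text \<open>The added summand is the multiplicity claimed for a maximum point, so the recursion
  mirrors the split of the length into hyperplane weight plus multiplicity.\<close>

lemma griesmer_fn_Suc:
  assumes "r \<le> k"
  shows "griesmer_fn q r (Suc k) x =
    griesmer_fn q r k x + \<lceil>real x / (real q ^ (Suc k - r) * q_number q r)\<rceil>"
  using assms by (simp add: griesmer_fn_def Suc_diff_le)

lemma antigriesmer_fn_Suc:
  assumes "r \<le> k"
  shows "antigriesmer_fn q r (Suc k) x =
    antigriesmer_fn q r k x + \<lfloor>real x / (real q ^ (Suc k - r) * q_number q r)\<rfloor>"
  using assms by (simp add: antigriesmer_fn_def Suc_diff_le)

text \<open>The quotient x [k] / (q^(k-r) [r]) is the Griesmer sum without any rounding; this is its
  recursion in k.\<close>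

lemma q_number_ratio_Suc:
  assumes "q \<ge> 2" "1 \<le> r" "r \<le> k"
  shows "real x * q_number q (Suc k) / (real q ^ (Suc k - r) * q_number q r) =
    real x * q_number q k / (real q ^ (k - r) * q_number q r) +
    real x / (real q ^ (Suc k - r) * q_number q r)"
proof -
  have eq: "x * (q * K + 1) / (q * a * b) = x * K / (a * b) + x / (q * a * b)"
    if "q \<noteq> 0" "a \<noteq> 0" "b \<noteq> 0" for x q K a b :: real
    using that by (simp add: divide_simps) (simp add: algebra_simps)
  show ?thesis
    unfolding q_number_Suc[OF assms(1)] Suc_diff_le[OF assms(3)] power_Suc
    using assms q_number_pos[OF assms(1,2)] by (intro eq) auto
qed

text \<open>Rounding every summand up can only increase the unrounded sum.\<close>

lemma griesmer_fn_ge: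
  assumes "q \<ge> 2" "1 \<le> r" "r \<le> k"
  shows "real x * q_number q k / (real q ^ (k - r) * q_number q r) \<le> griesmer_fn q r k x"
  using assms(3)
proof (induction k rule: dec_induct)
  case base
  then show ?case using q_number_pos[OF assms(1,2)] by (simp add: griesmer_fn_def)
next
  case (step k)
  then show ?case
    unfolding q_number_ratio_Suc[OF assms(1,2) step.hyps(1)] griesmer_fn_Suc[OF step.hyps(1)] of_int_add
    by (intro add_mono le_of_int_ceiling)
qed

lemma antigriesmer_fn_le:
  assumes "q \<ge> 2" "1 \<le> r" "r \<le> k"
  shows "antigriesmer_fn q r k x \<le> real x * q_number q k / (real q ^ (k - r) * q_number q r)"
  using assms(3)
proof (induction k rule: dec_induct)
  case base
  then show ?case using q_number_pos[OF assms(1,2)] by (simp add: antigriesmer_fn_def)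
next
  case (step k)
  then show ?case
    unfolding q_number_ratio_Suc[OF assms(1,2) step.hyps(1)] antigriesmer_fn_Suc[OF step.hyps(1)] of_int_add
    by (intro add_mono of_int_floor_le)
qed

text \<open>The leading x grows strictly and the rounded terms are monotone. Strictness lets a
  weight be recovered from a comparison of bounds.\<close>

lemma griesmer_fn_strict_mono:
  assumes "q \<ge> 2"
  shows "strict_mono (griesmer_fn q r k)"
proof (rule strict_monoI)
  fix x y :: nat assume "x < y"
  then show "griesmer_fn q r k x < griesmer_fn q r k y"
    unfolding griesmer_fn_def using q_number_nonneg[OF assms]
    by (intro add_less_le_mono sum_mono ceiling_mono divide_right_mono) auto
qed

lemma antigriesmer_fn_strict_mono:
  assumes "q \<ge> 2"
  shows "strict_mono (antigriesmer_fn q r k)"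
proof (rule strict_monoI)
  fix x y :: nat assume "x < y"
  then show "antigriesmer_fn q r k x < antigriesmer_fn q r k y"
    unfolding antigriesmer_fn_def using q_number_nonneg[OF assms]
    by (intro add_less_le_mono sum_mono floor_mono divide_right_mono) auto
qed

section \<open>Average multiplicity\<close>

lemma sum_card_dir_coords_real:
  fixes G :: "'a :: {field, finite} mat"
  assumes G: "G \<in> carrier_mat k n"
  shows "(\<Sum>p\<in>carrier_vec k - {0\<^sub>v k}. real (card (dir_coords G p))) =
    (real CARD('a) - 1) * real (weight n (encode G ` carrier_vec k))"
proof -
  have "(\<Sum>p\<in>carrier_vec k - {0\<^sub>v k}. real (card (dir_coords G p))) =
    real ((CARD('a) - 1) * weight n (encode G ` carrier_vec k))"
    unfolding sum_card_dir_coords[OF G, symmetric] by simp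
  then show ?thesis using card_ge_2[where 'a='a] by (simp add: of_nat_diff)
qed

lemma dir_coords_average_le:
  fixes G :: "'a :: {field, finite} mat" and m :: real
  assumes G: "G \<in> carrier_mat k n"
    and le: "\<And>p. p \<in> carrier_vec k \<Longrightarrow> p \<noteq> 0\<^sub>v k \<Longrightarrow> card (dir_coords G p) \<le> m"
  shows "weight n (encode G ` carrier_vec k) \<le> q_number CARD('a) k * m"
proof -
  let ?q = "CARD('a)"
  have "(\<Sum>p\<in>carrier_vec k - {0\<^sub>v k}. real (card (dir_coords G p))) \<le>
    real (card (carrier_vec k - {0\<^sub>v k} :: 'a vec set)) * m"
    using le by (intro sum_bounded_above) auto
  then have "(real ?q - 1) * weight n (encode G ` carrier_vec k) \<le> (real ?q ^ k - 1) * m"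
    unfolding sum_card_dir_coords_real[OF G] card_nonzero_vectors by (simp add: of_nat_diff)
  then have "(real ?q - 1) * weight n (encode G ` carrier_vec k) \<le> (real ?q - 1) * (q_number ?q k * m)"
    unfolding q_number_mult[OF card_ge_2, symmetric] by (simp add: mult.assoc)
  then show ?thesis using card_ge_2[where 'a='a] by simp
qed

lemma dir_coords_average_ge:
  fixes G :: "'a :: {field, finite} mat" and m :: real
  assumes G: "G \<in> carrier_mat k n"
    and ge: "\<And>p. p \<in> carrier_vec k \<Longrightarrow> p \<noteq> 0\<^sub>v k \<Longrightarrow> m \<le> card (dir_coords G p)"
  shows "q_number CARD('a) k * m \<le> weight n (encode G ` carrier_vec k)"
proof -
  let ?q = "CARD('a)"
  have "real (card (carrier_vec k - {0\<^sub>v k} :: 'a vec set)) * m \<le>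
    (\<Sum>p\<in>carrier_vec k - {0\<^sub>v k}. real (card (dir_coords G p)))"
    using ge by (intro sum_bounded_below) auto
  then have "(real ?q ^ k - 1) * m \<le> (real ?q - 1) * weight n (encode G ` carrier_vec k)"
    unfolding sum_card_dir_coords_real[OF G] card_nonzero_vectors by (simp add: of_nat_diff)
  then have "(real ?q - 1) * (q_number ?q k * m) \<le> (real ?q - 1) * weight n (encode G ` carrier_vec k)"
    unfolding q_number_mult[OF card_ge_2, symmetric] by (simp add: mult.assoc)
  then show ?thesis using card_ge_2[where 'a='a] by simp
qed

text \<open>Taking \<open>d\<close> as any lower bound, not the minimum, lets the hypothesis pass
  unchanged to hyperplane subcodes. Effective length replaces \<open>n\<close> because these
  subcodes keep their zero coordinates.\<close>

theorem griesmer_bound: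
  fixes C :: "'a :: {field, finite} vec set"
  assumes "linear_code n k C" "1 \<le> r" "r \<le> k"
    and "\<And>A. A \<in> subcodes n r C \<Longrightarrow> d \<le> weight n A"
  shows "griesmer_fn CARD('a) r k d \<le> weight n C"
  using assms(3,1,4)
proof (induction k arbitrary: C rule: dec_induct)
  case base
  then show ?case by (simp add: subcodes_self griesmer_fn_def)
next
  case (step k)
  let ?q = "CARD('a)" and ?g = "griesmer_fn CARD('a) r k d"
  have q: "?q \<ge> 2" by (rule card_ge_2)
  obtain G where G: "G \<in> carrier_mat (Suc k) n" "inj_on (encode G) (carrier_vec (Suc k))"
    and C: "C = encode G ` carrier_vec (Suc k)"
    using linear_code_encoder[OF step.prems(1)] .
  \<comment> \<open>By the induction hypothesis for hyperplane subcodes, \<open>y\<close> bounds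
    every multiplicity from above. It is an integer, which permits both subtraction and the final
    rounding.\<close>
  define y where "y = int (weight n C) - ?g"
  have "card (dir_coords G p) \<le> real_of_int y" if p: "p \<in> carrier_vec (Suc k)" "p \<noteq> 0\<^sub>v (Suc k)" for p
  proof -
    have "hyperplane_code G p \<subseteq> C" using G C by (auto simp: hyperplane_code_def)
    then have "?g \<le> weight n (hyperplane_code G p)"
      using subcodes_mono step.prems(2)
      by (intro step.IH linear_code_hyperplane_code[OF G p]) blast
    then show ?thesis using weight_encode_eq[OF G(1) p] by (simp add: y_def C)
  qed
  from dir_coords_average_le[OF G(1) this]
  \<comment> \<open>The weight of \<open>C\<close> is y + g, and [k+1] = q [k] + 1, so one
    \<open>y\<close> cancels.\<close>
  have "y + ?g \<le> (real ?q * q_number ?q k + 1) * y"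
    by (simp add: y_def C q_number_Suc[OF q])
  then have "?g \<le> real ?q * q_number ?q k * y" by (simp add: algebra_simps)
  \<comment> \<open>The unrounded estimate of g carries the same positive factor [k], which is
    cancelled next.\<close>
  with griesmer_fn_ge[OF q assms(2) step.hyps(1), of d]
  have "q_number ?q k * (d / (real ?q ^ (k - r) * q_number ?q r)) \<le> q_number ?q k * (real ?q * y)"
    by (simp add: mult_ac)
  then have "d / (real ?q ^ (k - r) * q_number ?q r) \<le> real ?q * y"
    by (rule mult_left_le_imp_le) (use q_number_pos[OF q, of k] assms(2) step.hyps(1) in simp)
  then have "d / (real ?q ^ (k - r) * q_number ?q r) / ?q \<le> real ?q * y / ?q"
    by (rule divide_right_mono) simp
  then have "d / (real ?q ^ (Suc k - r) * q_number ?q r) \<le> y"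
    using q by (simp add: Suc_diff_le[OF step.hyps(1)] mult_ac)
  then have "\<lceil>d / (real ?q ^ (Suc k - r) * q_number ?q r)\<rceil> \<le> y"
    by (simp only: ceiling_le_iff)
  then show ?case
    unfolding griesmer_fn_Suc[OF step.hyps(1)] y_def by linarith
qed

text \<open>Here the induction hypothesis bounds hyperplane weights from above, so all
  multiplicities are at least \<open>y\<close>, and the average bounds \<open>y\<close> from
  above.\<close>

theorem antigriesmer_bound:
  fixes C :: "'a :: {field, finite} vec set"
  assumes "linear_code n k C" "1 \<le> r" "r \<le> k"
    and "\<And>A. A \<in> subcodes n r C \<Longrightarrow> weight n A \<le> d"
  shows "weight n C \<le> antigriesmer_fn CARD('a) r k d"
  using assms(3,1,4)
proof (induction k arbitrary: C rule: dec_induct)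
  case base
  then show ?case by (simp add: subcodes_self antigriesmer_fn_def)
next
  case (step k)
  let ?q = "CARD('a)" and ?g = "antigriesmer_fn CARD('a) r k d"
  have q: "?q \<ge> 2" by (rule card_ge_2)
  obtain G where G: "G \<in> carrier_mat (Suc k) n" "inj_on (encode G) (carrier_vec (Suc k))"
    and C: "C = encode G ` carrier_vec (Suc k)"
    using linear_code_encoder[OF step.prems(1)] .
  define y where "y = int (weight n C) - ?g"
  have "real_of_int y \<le> card (dir_coords G p)" if p: "p \<in> carrier_vec (Suc k)" "p \<noteq> 0\<^sub>v (Suc k)" for p
  proof -
    have "hyperplane_code G p \<subseteq> C" using G C by (auto simp: hyperplane_code_def)
    then have "weight n (hyperplane_code G p) \<le> ?g"
      using subcodes_mono step.prems(2)
      by (intro step.IH linear_code_hyperplane_code[OF G p]) blast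
    then show ?thesis using weight_encode_eq[OF G(1) p] by (simp add: y_def C)
  qed
  from dir_coords_average_ge[OF G(1) this]
  have "(real ?q * q_number ?q k + 1) * y \<le> y + ?g"
    by (simp add: y_def C q_number_Suc[OF q])
  then have "real ?q * q_number ?q k * y \<le> ?g" by (simp add: algebra_simps)
  with antigriesmer_fn_le[OF q assms(2) step.hyps(1), of d]
  have "q_number ?q k * (real ?q * y) \<le> q_number ?q k * (d / (real ?q ^ (k - r) * q_number ?q r))"
    by (simp add: mult_ac)
  then have "real ?q * y \<le> d / (real ?q ^ (k - r) * q_number ?q r)"
    by (rule mult_left_le_imp_le) (use q_number_pos[OF q, of k] assms(2) step.hyps(1) in simp)
  then have "real ?q * y / ?q \<le> d / (real ?q ^ (k - r) * q_number ?q r) / ?q"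
    by (rule divide_right_mono) simp
  then have "y \<le> d / (real ?q ^ (Suc k - r) * q_number ?q r)"
    using q by (simp add: Suc_diff_le[OF step.hyps(1)] mult_ac)
  \<comment> \<open>Integrality of \<open>y\<close> allows rounding down.\<close>
  then have "y \<le> \<lfloor>d / (real ?q ^ (Suc k - r) * q_number ?q r)\<rfloor>"
    by (simp only: le_floor_iff)
  then show ?case
    unfolding antigriesmer_fn_Suc[OF step.hyps(1)] y_def by linarith
qed

subsection \<open>Puncturing at zero coordinates\<close>

definition puncture :: "nat list \<Rightarrow> 'a vec \<Rightarrow> 'a vec" where
  "puncture ks v = vec_of_list (map (\<lambda>j. v $ j) ks)"

lemma puncture_simps [simp]:
  "dim_vec (puncture ks v) = length ks"
  "i < length ks \<Longrightarrow> puncture ks v $ i = v $ (ks ! i)"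
  by (auto simp: puncture_def vec_of_list_index)

text \<open>Only coordinates vanishing on all of \<open>C\<close> are dropped, so puncturing
  preserves dimension and weight.\<close>

locale supported_code =
  fixes n :: nat and ks :: "nat list" and C :: "'a :: {field, finite} vec set"
  assumes C: "vec_subspace n C"
    and ks: "distinct ks" "set ks \<subseteq> {..<n}" "supp n C \<subseteq> set ks"
begin

lemma nth_less: "i < length ks \<Longrightarrow> ks ! i < n"
  using ks(2) nth_mem by blast

lemma puncture_add:
  "u \<in> carrier_vec n \<Longrightarrow> v \<in> carrier_vec n \<Longrightarrow> puncture ks (u + v) = puncture ks u + puncture ks v"
  by (intro eq_vecI) (auto simp: nth_less)

lemma puncture_smult: "v \<in> carrier_vec n \<Longrightarrow> puncture ks (c \<cdot>\<^sub>v v) = c \<cdot>\<^sub>v puncture ks v"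
  by (intro eq_vecI) (auto simp: nth_less)

lemma puncture_zero: "puncture ks (0\<^sub>v n) = 0\<^sub>v (length ks)"
  by (intro eq_vecI) (auto simp: nth_less)

lemma inj_on_puncture: "inj_on (puncture ks) C"
proof (rule inj_onI)
  fix u v assume uv: "u \<in> C" "v \<in> C" and eq: "puncture ks u = puncture ks v"
  have carr: "u \<in> carrier_vec n" "v \<in> carrier_vec n" using vec_subspaceD(1)[OF C] uv by auto
  show "u = v"
  proof (intro eq_vecI)
    fix j assume "j < dim_vec v"
    then have j: "j < n" using carr by simp
    show "u $ j = v $ j"
    proof (cases "j \<in> set ks")
      case True
      then obtain i where "i < length ks" "ks ! i = j" by (auto simp: in_set_conv_nth)
      then show ?thesis using arg_cong[OF eq, of "\<lambda>w. w $ i"] by simp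
    next
      case False
      then have "j \<notin> supp n C" using ks(3) by blast
      then have "u $ j = 0" "v $ j = 0" using j uv unfolding supp_def by blast+
      then show ?thesis by simp
    qed
  qed (use carr in auto)
qed

lemma vec_subspace_puncture:
  assumes "vec_subspace n A"
  shows "vec_subspace (length ks) (puncture ks ` A)"
proof (rule vec_subspaceI)
  note A = vec_subspaceD[OF assms]
  show "puncture ks ` A \<subseteq> carrier_vec (length ks)" by (auto intro: carrier_vecI)
  show "0\<^sub>v (length ks) \<in> puncture ks ` A" using A(2) puncture_zero by (metis imageI)
  fix u v assume "u \<in> puncture ks ` A" "v \<in> puncture ks ` A"
  then obtain x y where "x \<in> A" "y \<in> A" "u = puncture ks x" "v = puncture ks y" by blast
  moreover from this have "u + v = puncture ks (x + y)"
    using A(1) by (simp add: puncture_add subset_iff)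
  ultimately show "u + v \<in> puncture ks ` A" using A(3) by blast
next
  note A = vec_subspaceD[OF assms]
  fix c v assume "v \<in> puncture ks ` A"
  then obtain x where "x \<in> A" "v = puncture ks x" by blast
  moreover from this have "c \<cdot>\<^sub>v v = puncture ks (c \<cdot>\<^sub>v x)"
    using A(1) by (simp add: puncture_smult subset_iff)
  ultimately show "c \<cdot>\<^sub>v v \<in> puncture ks ` A" using A(4) by blast
qed

lemma linear_code_puncture:
  assumes "A \<subseteq> C" "linear_code n m A"
  shows "linear_code (length ks) m (puncture ks ` A)"
  using assms vec_subspace_puncture[of A] card_image[OF inj_on_subset[OF inj_on_puncture assms(1)]]
  by (simp add: linear_code_iff_card)

text \<open>Re-indexing is a bijection of supports: distinctness gives injectivity, and containment
  of the support in \<open>ks\<close> gives surjectivity.\<close>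

lemma weight_puncture:
  assumes "A \<subseteq> C"
  shows "weight (length ks) (puncture ks ` A) = weight n A"
proof -
  have eq: "supp (length ks) (puncture ks ` A) = {i. i < length ks \<and> ks ! i \<in> supp n A}"
    unfolding supp_def by (simp add: nth_less cong: conj_cong)
  have "supp n A \<subseteq> set ks" using assms ks(3) unfolding supp_def by blast
  then have "(\<lambda>i. ks ! i) ` {i. i < length ks \<and> ks ! i \<in> supp n A} = supp n A"
    unfolding set_conv_nth by blast
  moreover have "inj_on (\<lambda>i. ks ! i) {i. i < length ks \<and> ks ! i \<in> supp n A}"
    using ks(1) by (intro inj_on_nth) auto
  ultimately have "bij_betw (\<lambda>i. ks ! i) (supp (length ks) (puncture ks ` A)) (supp n A)"
    unfolding eq bij_betw_def by blast
  then show ?thesis unfolding weight_def by (rule bij_betw_same_card)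
qed

lemma subcodes_puncture:
  "subcodes (length ks) r (puncture ks ` C) = (`) (puncture ks) ` subcodes n r C" (is "?L = ?R")
proof
  show "?R \<subseteq> ?L" using linear_code_puncture by (auto simp: subcodes_def)
  show "?L \<subseteq> ?R"
  proof
    fix B assume "B \<in> ?L"
    then have B: "B \<subseteq> puncture ks ` C" "linear_code (length ks) r B" by (auto simp: subcodes_def)
    \<comment> \<open>The preimage of \<open>B\<close> within the code is a subspace, and
      injectivity gives it the size of \<open>B\<close>.\<close>
    define A where "A = {v \<in> C. puncture ks v \<in> B}"
    have AC: "A \<subseteq> C" and BA: "B = puncture ks ` A" using B(1) by (auto simp: A_def)
    have Bsub: "vec_subspace (length ks) B" using B(2) by (simp add: linear_code_iff_card)
    have "vec_subspace n A"
    proof (rule vec_subspaceI)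
      note C' = vec_subspaceD[OF C] and B' = vec_subspaceD[OF Bsub]
      show "A \<subseteq> carrier_vec n" using AC C'(1) by blast
      show "0\<^sub>v n \<in> A" using C'(2) B'(2) by (simp add: A_def puncture_zero)
      show "u + v \<in> A" if "u \<in> A" "v \<in> A" for u v
        using that C'(1,3) B'(3) by (simp add: A_def puncture_add subset_iff)
      show "c \<cdot>\<^sub>v v \<in> A" if "v \<in> A" for c v
        using that C'(1,4) B'(4) by (simp add: A_def puncture_smult subset_iff)
    qed
    moreover have "card A = card B"
      unfolding BA by (rule card_image[symmetric, OF inj_on_subset[OF inj_on_puncture AC]])
    ultimately have "linear_code n r A" using B(2) by (simp add: linear_code_iff_card)
    then show "B \<in> ?R" using AC BA by (auto simp: subcodes_def)
  qed
qed

text \<open>Equality of the weight sets yields equality of the minimum and of the maximum subcode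
  weight at once.\<close>

lemma weights_puncture:
  "weight (length ks) ` subcodes (length ks) r (puncture ks ` C) = weight n ` subcodes n r C"
  unfolding subcodes_puncture image_image
  by (intro image_cong refl weight_puncture) (simp add: subcodes_def)

end

subsection \<open>Shortening at a point\<close>

lemma line_of_eq_iff:
  fixes g p :: "'a :: {field, finite} vec"
  assumes g: "g \<in> carrier_vec k" "g \<noteq> 0\<^sub>v k" and p: "p \<in> carrier_vec k"
  shows "line_of k g = line_of k p \<longleftrightarrow> (\<exists>c. g = c \<cdot>\<^sub>v p)"
proof
  assume "line_of k g = line_of k p"
  moreover have "g = 1 \<cdot>\<^sub>v g" by simp
  ultimately show "\<exists>c. g = c \<cdot>\<^sub>v p" unfolding line_of_eq[OF g(1)] line_of_eq[OF p] by blast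
next
  assume "\<exists>c. g = c \<cdot>\<^sub>v p"
  then obtain c where c: "g = c \<cdot>\<^sub>v p" by blast
  then have "c \<noteq> 0" using g p by auto
  then have "d \<cdot>\<^sub>v p = (d / c) \<cdot>\<^sub>v g" for d by (simp add: c smult_smult_assoc)
  moreover have "d \<cdot>\<^sub>v g = (d * c) \<cdot>\<^sub>v p" for d by (simp add: c smult_smult_assoc)
  ultimately show "line_of k g = line_of k p"
    unfolding line_of_eq[OF g(1)] line_of_eq[OF p] by blast
qed

text \<open>Counting decides: the zero vector has a single multiple, a nonzero vector has q of
  them.\<close>

lemma line_of_in_proj_points_iff:
  fixes p :: "'a :: {field, finite} vec"
  assumes p: "p \<in> carrier_vec k"
  shows "line_of k p \<in> proj_points k \<longleftrightarrow> p \<noteq> 0\<^sub>v k"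
proof
  assume "line_of k p \<in> proj_points k"
  then have "card (range (\<lambda>c. c \<cdot>\<^sub>v p)) = CARD('a)"
    by (simp add: proj_points_def linear_code_iff_card line_of_eq[OF p])
  moreover have "c \<cdot>\<^sub>v 0\<^sub>v k = 0\<^sub>v k" for c :: 'a by (intro eq_vecI) auto
  ultimately show "p \<noteq> 0\<^sub>v k" using card_ge_2[where 'a='a] by auto
next
  assume nz: "p \<noteq> 0\<^sub>v k"
  obtain i where i: "i < k" "p $ i \<noteq> 0" using ex_nonzero_entry[OF p nz] .
  have "inj (\<lambda>c. c \<cdot>\<^sub>v p)"
  proof (rule injI)
    fix c d assume "c \<cdot>\<^sub>v p = d \<cdot>\<^sub>v p"
    then have "(c \<cdot>\<^sub>v p) $ i = (d \<cdot>\<^sub>v p) $ i" by simp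
    then show "c = d" using i p by simp
  qed
  then have "card (line_of k p) = CARD('a) ^ 1" by (simp add: line_of_eq[OF p] card_image)
  moreover have "vec_subspace k (line_of k p)" using vec_subspace_multiples[OF p] by (simp add: line_of_eq[OF p])
  ultimately show "line_of k p \<in> proj_points k"
    by (simp add: proj_points_def linear_code_iff_card)
qed

text \<open>The code has dimension \<open>Suc k\<close>, so that the shortened code has dimension
  \<open>k\<close>; \<open>p\<close> represents the point.\<close>

locale shortening =
  fixes n k :: nat and G :: "'a :: {field, finite} mat" and C :: "'a vec set" and p :: "'a vec"
  assumes full: "full_length_code n (Suc k) C"
    and gen: "generator_matrix (Suc k) n G C"
    and p: "p \<in> carrier_vec (Suc k)" "p \<noteq> 0\<^sub>v (Suc k)"
begin

lemma G: "G \<in> carrier_mat (Suc k) n"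
  using gen by (simp add: generator_matrix_def)

lemma C_eq: "C = encode G ` carrier_vec (Suc k)"
  using gen encode_row_space[OF G] by (simp add: generator_matrix_def)

lemma weight_C: "weight n C = n"
  using full by (simp add: full_length_code_def)

lemma inj_on_encode: "inj_on (encode G) (carrier_vec (Suc k))"
proof (rule eq_card_imp_inj_on)
  have "card C = CARD('a) ^ Suc k"
    using full by (simp add: full_length_code_def linear_code_iff_card)
  then show "card (encode G ` carrier_vec (Suc k)) = card (carrier_vec (Suc k) :: 'a vec set)"
    by (simp add: C_eq card_carrier_vec)
qed simp

lemma col_nonzero:
  assumes "j < n"
  shows "col G j \<noteq> 0\<^sub>v (Suc k)"
proof -
  \<comment> \<open>Full length means that every coordinate is in the support.\<close>
  have "supp n C = {..<n}"
    using weight_C by (intro card_subset_eq) (auto simp: weight_def supp_def)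
  then show ?thesis using assms by (auto simp: C_eq supp_encode[OF G])
qed

lemma point_mult_line_of:
  assumes "p' \<in> carrier_vec (Suc k)"
  shows "point_mult G (line_of (Suc k) p') = card (dir_coords G p')"
proof -
  have "{j. j < dim_col G \<and> line_of (dim_row G) (col G j) = line_of (Suc k) p'} = dir_coords G p'"
    using G col_nonzero line_of_eq_iff[OF col_carrier[OF G] col_nonzero assms]
    by (auto simp: dir_coords_def)
  then show ?thesis by (simp add: point_mult_def)
qed

text \<open>Shortening thus deletes precisely the zero coordinates of the hyperplane subcode, as
  puncturing requires.\<close>

lemma set_kept_coords: "set (kept_coords G p) = supp n (hyperplane_code G p)"
  using G line_of_eq_iff[OF col_carrier[OF G] col_nonzero p(1)]
  by (auto simp: kept_coords_def supp_hyperplane_code[OF G p])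

lemma linear_code_hyperplane: "linear_code n k (hyperplane_code G p)"
  by (rule linear_code_hyperplane_code[OF G inj_on_encode p])

lemma hyperplane_code_subset: "hyperplane_code G p \<subseteq> C"
  using G by (auto simp: hyperplane_code_def C_eq)

sublocale supported_code n "kept_coords G p" "hyperplane_code G p"
proof
  show "vec_subspace n (hyperplane_code G p)"
    using linear_code_hyperplane by (simp add: linear_code_iff_card)
  show "distinct (kept_coords G p)" by (simp add: kept_coords_def)
  show "set (kept_coords G p) \<subseteq> {..<n}" "supp n (hyperplane_code G p) \<subseteq> set (kept_coords G p)"
    unfolding set_kept_coords by (auto simp: supp_def)
qed

lemma shortened_subcode_eq:
  "shortened_subcode G p = puncture (kept_coords G p) ` hyperplane_code G p"
proof -
  have "vec_of_list (map (\<lambda>j. x \<bullet> col G j) (kept_coords G p)) =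
    puncture (kept_coords G p) (encode G x)" for x
    unfolding puncture_def by (intro arg_cong[of _ _ vec_of_list] map_cong refl)
      (simp add: kept_coords_def)
  then show ?thesis
    using G by (auto simp: shortened_subcode_def hyperplane_code_def image_iff)
qed

lemma shortened_length_eq: "shortened_length G p = weight n (hyperplane_code G p)"
  unfolding shortened_length_def weight_def set_kept_coords[symmetric]
  by (rule distinct_card[symmetric]) (rule ks(1))

lemma linear_code_shortened: "linear_code (shortened_length G p) k (shortened_subcode G p)"
  unfolding shortened_subcode_eq shortened_length_def
  by (rule linear_code_puncture[OF subset_refl linear_code_hyperplane])

lemma weight_shortened:
  "weight (shortened_length G p) (shortened_subcode G p) = weight n (hyperplane_code G p)"
  unfolding shortened_subcode_eq shortened_length_def by (rule weight_puncture[OF subset_refl])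

lemma weights_shortened:
  "weight (shortened_length G p) ` subcodes (shortened_length G p) r (shortened_subcode G p) =
    weight n ` subcodes n r (hyperplane_code G p)"
  unfolding shortened_subcode_eq shortened_length_def by (rule weights_puncture)

lemma full_length_shortened: "full_length_code (shortened_length G p) k (shortened_subcode G p)"
  using linear_code_shortened weight_shortened shortened_length_eq by (simp add: full_length_code_def)

lemma weight_hyperplane_add_point_mult:
  "weight n (hyperplane_code G p) + point_mult G (line_of (Suc k) p) = n"
  using weight_encode_eq[OF G p] weight_C by (simp add: C_eq point_mult_line_of[OF p(1)])

text \<open>Two lower bounds, one for the multiplicity and one for the hyperplane weight, add up
  exactly to the length, so both are equalities.\<close>

lemma griesmer_shortening:
  assumes r: "1 \<le> r" "r \<le> k"
    and griesmer: "griesmer_code r n (Suc k) C"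
    and max: "max_point G (line_of (Suc k) p)"
    and d: "d = min_subcode_weight n r C"
  shows "int (point_mult G (line_of (Suc k) p)) =
      \<lceil>real d / (real CARD('a) ^ (Suc k - r) * q_number CARD('a) r)\<rceil>" (is "int ?mu = ?c")
    and "int (weight n (hyperplane_code G p)) = griesmer_fn CARD('a) r k d" (is "int ?w = ?g")
    and "min_subcode_weight (shortened_length G p) r (shortened_subcode G p) = d"
proof -
  let ?q = "CARD('a)" and ?H = "hyperplane_code G p"
  let ?s = "real ?q ^ (Suc k - r) * q_number ?q r"
  let ?d' = "min_subcode_weight (shortened_length G p) r (shortened_subcode G p)"
  have q: "?q \<ge> 2" by (rule card_ge_2)
  have n: "int n = griesmer_fn ?q r (Suc k) d"
    using griesmer by (simp add: griesmer_code_def d)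
  then have N: "real n = griesmer_fn ?q r (Suc k) d" by (metis of_int_of_nat_eq)
  have d_le: "d \<le> weight n A" if "A \<in> subcodes n r ?H" for A
    using that subcodes_mono[OF hyperplane_code_subset]
    by (auto simp: d min_subcode_weight_def intro!: Min_le)
  have d': "?d' \<in> weight n ` subcodes n r ?H" "\<And>A. A \<in> subcodes n r ?H \<Longrightarrow> ?d' \<le> weight n A"
    unfolding min_subcode_weight_def weights_shortened
    using subcodes_nonempty[OF linear_code_hyperplane r(2)]
    by (auto intro!: Min_in)
  \<comment> \<open>Every nonzero vector spans a point, so maximality applies to all directions and
    the average bounds \<open>?mu\<close> from below.\<close>
  have "card (dir_coords G p') \<le> real ?mu" if p': "p' \<in> carrier_vec (Suc k)" "p' \<noteq> 0\<^sub>v (Suc k)" for p'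
    using max p' G line_of_in_proj_points_iff[OF p'(1)]
    by (auto simp: max_point_def point_mult_line_of[symmetric])
  from dir_coords_average_le[OF G this]
  have "n \<le> q_number ?q (Suc k) * ?mu" by (simp add: C_eq[symmetric] weight_C)
  moreover have "real d * q_number ?q (Suc k) / ?s \<le> n"
    using griesmer_fn_ge[OF q r(1), of "Suc k" d] r(2) N by simp
  ultimately have "q_number ?q (Suc k) * (d / ?s) \<le> q_number ?q (Suc k) * ?mu"
    by (simp add: mult.commute)
  then have "d / ?s \<le> ?mu"
    by (rule mult_left_le_imp_le) (simp add: q_number_pos[OF q])
  then have "?c \<le> ?mu" by (simp add: ceiling_le_iff)
  moreover have "?g \<le> ?w" by (rule griesmer_bound[OF linear_code_hyperplane r d_le])
  \<comment> \<open>The sum of the left-hand sides is \<open>n\<close>, and so is that of the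
    right-hand sides by the recursion.\<close>
  ultimately show mu: "int ?mu = ?c" and w: "int ?w = ?g"
    using n[unfolded griesmer_fn_Suc[OF r(2)]] weight_hyperplane_add_point_mult by linarith+
  \<comment> \<open>The bound is applied again, now with the minimum weight of the hyperplane
    subcode itself; strict monotonicity excludes a value above \<open>d\<close>.\<close>
  have "griesmer_fn ?q r k ?d' \<le> griesmer_fn ?q r k d"
    using griesmer_bound[OF linear_code_hyperplane r d'(2)] w by simp
  then have "?d' \<le> d" using strict_mono_less_eq[OF griesmer_fn_strict_mono[OF q]] by blast
  moreover have "d \<le> ?d'" using d'(1) d_le by auto
  ultimately show "?d' = d" by simp
qed

text \<open>Dually, two upper bounds add up exactly to the length. Points of multiplicity 0 are
  covered, since minimality ranges over all points.\<close>

lemma antigriesmer_shortening: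
  assumes r: "1 \<le> r" "r \<le> k"
    and antigriesmer: "antigriesmer_code r n (Suc k) C"
    and min: "min_point G (line_of (Suc k) p)"
    and d: "d = max_subcode_weight n r C"
  shows "int (point_mult G (line_of (Suc k) p)) =
      \<lfloor>real d / (real CARD('a) ^ (Suc k - r) * q_number CARD('a) r)\<rfloor>" (is "int ?mu = ?c")
    and "int (weight n (hyperplane_code G p)) = antigriesmer_fn CARD('a) r k d" (is "int ?w = ?g")
    and "max_subcode_weight (shortened_length G p) r (shortened_subcode G p) = d"
proof -
  let ?q = "CARD('a)" and ?H = "hyperplane_code G p"
  let ?s = "real ?q ^ (Suc k - r) * q_number ?q r"
  let ?d' = "max_subcode_weight (shortened_length G p) r (shortened_subcode G p)"
  have q: "?q \<ge> 2" by (rule card_ge_2)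
  have n: "int n = antigriesmer_fn ?q r (Suc k) d"
    using antigriesmer by (simp add: antigriesmer_code_def d)
  then have N: "real n = antigriesmer_fn ?q r (Suc k) d" by (metis of_int_of_nat_eq)
  have d_ge: "weight n A \<le> d" if "A \<in> subcodes n r ?H" for A
    using that subcodes_mono[OF hyperplane_code_subset]
    by (auto simp: d max_subcode_weight_def intro!: Max_ge)
  have d': "?d' \<in> weight n ` subcodes n r ?H" "\<And>A. A \<in> subcodes n r ?H \<Longrightarrow> weight n A \<le> ?d'"
    unfolding max_subcode_weight_def weights_shortened
    using subcodes_nonempty[OF linear_code_hyperplane r(2)]
    by (auto intro!: Max_in)
  have "real ?mu \<le> card (dir_coords G p')" if p': "p' \<in> carrier_vec (Suc k)" "p' \<noteq> 0\<^sub>v (Suc k)" for p'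
    using min p' G line_of_in_proj_points_iff[OF p'(1)]
    by (auto simp: min_point_def point_mult_line_of[symmetric])
  from dir_coords_average_ge[OF G this]
  have "q_number ?q (Suc k) * ?mu \<le> n" by (simp add: C_eq[symmetric] weight_C)
  moreover have "n \<le> real d * q_number ?q (Suc k) / ?s"
    using antigriesmer_fn_le[OF q r(1), of "Suc k" d] r(2) N by simp
  ultimately have "q_number ?q (Suc k) * ?mu \<le> q_number ?q (Suc k) * (d / ?s)"
    by (simp add: mult.commute)
  then have "?mu \<le> d / ?s"
    by (rule mult_left_le_imp_le) (simp add: q_number_pos[OF q])
  then have "?mu \<le> ?c" by (simp add: le_floor_iff)
  moreover have "?w \<le> ?g" by (rule antigriesmer_bound[OF linear_code_hyperplane r d_ge])
  ultimately show mu: "int ?mu = ?c" and w: "int ?w = ?g"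
    using n[unfolded antigriesmer_fn_Suc[OF r(2)]] weight_hyperplane_add_point_mult by linarith+
  have "antigriesmer_fn ?q r k d \<le> antigriesmer_fn ?q r k ?d'"
    using antigriesmer_bound[OF linear_code_hyperplane r d'(2)] w by simp
  then have "d \<le> ?d'" using strict_mono_less_eq[OF antigriesmer_fn_strict_mono[OF q]] by blast
  moreover have "?d' \<le> d" using d'(1) d_ge by auto
  ultimately show "?d' = d" by simp
qed

end

theorem theorem6p4:
  fixes C :: "'a :: {field, finite} vec set"
    and G :: "'a mat"
    and q r k n d \<delta> :: nat
  assumes "q = CARD('a)"
    and "1 \<le> r" and "r < k"
    and "full_length_code n k C"
    and "generator_matrix k n G C"
    and "d = min_subcode_weight n r C"
    and "\<delta> = max_subcode_weight n r C"
  shows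
    "(griesmer_code r n k C \<longrightarrow>
       (\<forall>P. \<forall>p \<in> carrier_vec k. P = line_of k p \<and> max_point G P \<longrightarrow>
         (let C\<^sub>P = shortened_subcode G p; n\<^sub>P = shortened_length G p in
            int (point_mult G P) = \<lceil>real d / (real q ^ (k - r) * q_number q r)\<rceil> \<and>
            int (eff_length n\<^sub>P C\<^sub>P) = griesmer_fn q r (k - 1) d \<and>
            min_subcode_weight n\<^sub>P r C\<^sub>P = d \<and>
            linear_code n\<^sub>P (k - 1) C\<^sub>P \<and>
            griesmer_code r n\<^sub>P (k - 1) C\<^sub>P))) \<and>
     (antigriesmer_code r n k C \<longrightarrow>
       (\<forall>P. \<forall>p \<in> carrier_vec k. P = line_of k p \<and> min_point G P \<longrightarrow>
         (let C\<^sub>P = shortened_subcode G p; n\<^sub>P = shortened_length G p in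
            int (point_mult G P) = \<lfloor>real \<delta> / (real q ^ (k - r) * q_number q r)\<rfloor> \<and>
            int (eff_length n\<^sub>P C\<^sub>P) = antigriesmer_fn q r (k - 1) \<delta> \<and>
            max_subcode_weight n\<^sub>P r C\<^sub>P = \<delta> \<and>
            linear_code n\<^sub>P (k - 1) C\<^sub>P \<and>
            antigriesmer_code r n\<^sub>P (k - 1) C\<^sub>P)))"
proof -
  obtain k' where k: "k = Suc k'" and r: "r \<le> k'"
    using assms(3) by (cases k) auto
  have dim_row: "dim_row G = Suc k'" using assms(5) by (auto simp: generator_matrix_def k)
  \<comment> \<open>That \<open>p\<close> spans a point amounts to \<open>p\<close> being
    nonzero.\<close>
  have sh: "shortening n k' G C p"
    if "p \<in> carrier_vec (Suc k')" "line_of (Suc k') p \<in> proj_points (dim_row G)" for p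
    using that assms(4,5) line_of_in_proj_points_iff[OF that(1)]
    by unfold_locales (auto simp: k dim_row)
  show ?thesis
  proof (intro conjI impI allI ballI)
    fix P p assume griesmer: "griesmer_code r n k C" and p: "p \<in> carrier_vec k"
      and P: "P = line_of k p \<and> max_point G P"
    interpret shortening n k' G C p using P p by (intro sh) (auto simp: k max_point_def)
    have point: "max_point G (line_of (Suc k') p)" using P by (auto simp: k)
    note * = griesmer_shortening[OF assms(2) r griesmer[unfolded k] point assms(6)]
    \<comment> \<open>The kept coordinates are the support of the hyperplane subcode, so its weight
      is the length of the shortened code.\<close>
    have length: "int (shortened_length G p) = griesmer_fn q r k' d"
      using *(2) assms(1) by (simp add: shortened_length_eq)
    show "let C\<^sub>P = shortened_subcode G p; n\<^sub>P = shortened_length G p in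
            int (point_mult G P) = \<lceil>real d / (real q ^ (k - r) * q_number q r)\<rceil> \<and>
            int (eff_length n\<^sub>P C\<^sub>P) = griesmer_fn q r (k - 1) d \<and>
            min_subcode_weight n\<^sub>P r C\<^sub>P = d \<and>
            linear_code n\<^sub>P (k - 1) C\<^sub>P \<and>
            griesmer_code r n\<^sub>P (k - 1) C\<^sub>P"
      using P *(1,3) length full_length_shortened assms(1,2) r
      by (simp add: Let_def k griesmer_code_def full_length_code_def)
  next
    fix P p assume antigriesmer: "antigriesmer_code r n k C" and p: "p \<in> carrier_vec k"
      and P: "P = line_of k p \<and> min_point G P"
    interpret shortening n k' G C p using P p by (intro sh) (auto simp: k min_point_def)
    have point: "min_point G (line_of (Suc k') p)" using P by (auto simp: k)
    note * = antigriesmer_shortening[OF assms(2) r antigriesmer[unfolded k] point assms(7)]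
    have length: "int (shortened_length G p) = antigriesmer_fn q r k' \<delta>"
      using *(2) assms(1) by (simp add: shortened_length_eq)
    show "let C\<^sub>P = shortened_subcode G p; n\<^sub>P = shortened_length G p in
            int (point_mult G P) = \<lfloor>real \<delta> / (real q ^ (k - r) * q_number q r)\<rfloor> \<and>
            int (eff_length n\<^sub>P C\<^sub>P) = antigriesmer_fn q r (k - 1) \<delta> \<and>
            max_subcode_weight n\<^sub>P r C\<^sub>P = \<delta> \<and>
            linear_code n\<^sub>P (k - 1) C\<^sub>P \<and>
            antigriesmer_code r n\<^sub>P (k - 1) C\<^sub>P"
      using P *(1,3) length full_length_shortened assms(1,2) r
      by (simp add: Let_def k antigriesmer_code_def full_length_code_def)
  qed
qed

end
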